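(* For any connected graph $G$, \[ \sqrt{s^{-}(G)} \le R(G), \] with equality if and only if $G$ is a complete bipartite graph.
   Context: All graphs are finite, simple and undirected. For a graph $G$ on $n$ vertices with adjacency matrix $A$, let $\mu_1(G) \ge \dots \ge \mu_n(G)$ be the eigenvalues of $A$ counted with multiplicity. Define $s^{-}(G) = \sum_{i:\, \mu_i(G) < 0} \mu_i(G)^2$, the sum of the squares of the negative eigenvalues of $A$. The Randić index of $G$ is $R(G) = \sum_{ij \in E} \frac{1}{\sqrt{d_i d_j}}$, where $E$ is the edge set of $G$ and $d_i$ is the degree of vertex $i$. A complete bipartite graph is a graph whose vertex set can be partitioned into two sets such that two vertices are adjacent exactly when they lie in different sets. *)

theory Defs
  imports
    "Graph_Theory.Kuratowski"
    "Jordan_Normal_Form.Char_Poly"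
begin

text \<open>
  Finite simple undirected graphs are the locale predicate \<open>graph\<close>: finite symmetric digraphs
  without loops and parallel arcs, so that each undirected edge is a pair of opposite arcs.
\<close>

text \<open>The vertex list \<open>vs\<close> enumerates the vertices and fixes the order of rows and columns.\<close>

definition adjacency_mat :: "('a, 'b) pre_digraph \<Rightarrow> 'a list \<Rightarrow> real mat" where
  "adjacency_mat G vs = mat (length vs) (length vs)
     (\<lambda>(i, j). if (vs ! i, vs ! j) \<in> arcs_ends G then 1 else 0)"

definition vertex_list :: "('a, 'b) pre_digraph \<Rightarrow> 'a list" where
  "vertex_list G = (SOME vs. distinct vs \<and> set vs = verts G)"

lemma vertex_list:
  assumes "finite (verts G)"
  shows "distinct (vertex_list G)" and "set (vertex_list G) = verts G"
proof -
  from finite_distinct_list[OF assms] obtain vs where "distinct vs \<and> set vs = verts G"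
    by blast
  then have "distinct (vertex_list G) \<and> set (vertex_list G) = verts G"
    unfolding vertex_list_def by (rule someI)
  then show "distinct (vertex_list G)" "set (vertex_list G) = verts G"
    by auto
qed

text \<open>
  The multiset of adjacency eigenvalues, each with its multiplicity as a root of the characteristic
  polynomial. Since the matrix is real symmetric, this polynomial splits over the reals,
  so no eigenvalue is lost by taking real roots only.
\<close>

definition graph_eigenvalues :: "('a, 'b) pre_digraph \<Rightarrow> real multiset" where
  "graph_eigenvalues G = proots (char_poly (adjacency_mat G (vertex_list G)))"

definition s_minus :: "('a, 'b) pre_digraph \<Rightarrow> real" where
  "s_minus G = (\<Sum>\<mu> \<in># filter_mset (\<lambda>\<mu>. \<mu> < 0) (graph_eigenvalues G). \<mu>\<^sup>2)"

definition undirected_edges :: "('a, 'b) pre_digraph \<Rightarrow> 'a set set" where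
  "undirected_edges G = (\<lambda>(u, v). {u, v}) ` arcs_ends G"

text \<open>
  In a simple graph the out-degree of a vertex is its number of neighbours, and every edge has two
  distinct endpoints, so the product below is that of the two endpoint degrees.
\<close>

definition randic_index :: "('a, 'b) pre_digraph \<Rightarrow> real" where
  "randic_index G = (\<Sum>e \<in> undirected_edges G. 1 / sqrt (\<Prod>v \<in> e. real (out_degree G v)))"

text \<open>The eigenvalues do not depend on the chosen enumeration of the vertices.\<close>

lemma char_poly_adjacency_mat_cong:
  assumes "distinct vs" "distinct ws" "set vs = set ws"
  shows "char_poly (adjacency_mat G vs) = char_poly (adjacency_mat G ws)"
proof -
  from assms have "mset ws = mset vs"
    by (metis set_eq_iff_mset_eq_distinct)
  then obtain p where p: "p permutes {..<length vs}" and ws: "permute_list p vs = ws"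
    by (rule mset_eq_permutation)
  define n where "n = length vs"
  have n: "length vs = n" "length ws = n"
    using ws by (auto simp: n_def)
  have p': "p permutes {0..<n}"
    using p by (simp add: n_def atLeast0LessThan)
  have wsi: "ws ! i = vs ! p i" and pi: "p i < n" if "i < n" for i
    using that p ws permute_list_nth[OF p] permutes_in_image[OF p] by (auto simp: n_def)
  have inj: "p i = p j \<longleftrightarrow> i = j" for i j
    using permutes_inj[OF p] by (auto dest: injD)
  define M where "M = char_poly_matrix (adjacency_mat G vs)"
  have M: "M \<in> carrier_mat n n"
    by (simp add: M_def adjacency_mat_def char_poly_matrix_def n)
  define M1 where "M1 = mat n n (\<lambda>(i, j). M $$ (p i, j))"
  have M1: "M1 \<in> carrier_mat n n"
    by (simp add: M1_def)
  define M2 where "M2 = mat n n (\<lambda>(i, j). M1\<^sup>T $$ (p i, j))"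
  have M2: "M2 \<in> carrier_mat n n"
    by (simp add: M2_def)
  have eq: "char_poly_matrix (adjacency_mat G ws) = M2\<^sup>T"
    by (rule eq_matI)
      (auto simp: M2_def M1_def M_def adjacency_mat_def char_poly_matrix_def n wsi pi inj)
  have "det (M2\<^sup>T) = signof p * (signof p * det M)"
    using det_permute_rows[OF M p'] det_permute_rows[OF transpose_carrier_mat[THEN iffD2, OF M1] p']
      det_transpose[OF M1] det_transpose[OF M2]
    by (simp add: M2_def M1_def)
  also have "\<dots> = det M"
    by (auto simp: sign_def)
  finally show ?thesis
    by (simp add: char_poly_def eq M_def)
qed

lemma graph_eigenvalues_eq:
  assumes "distinct vs" "set vs = verts G"
  shows "graph_eigenvalues G = proots (char_poly (adjacency_mat G vs))"
proof -
  have "finite (verts G)"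
    using assms(2) by (metis List.finite_set)
  then show ?thesis
    unfolding graph_eigenvalues_def
    using vertex_list[of G] assms char_poly_adjacency_mat_cong[of "vertex_list G" vs G] by simp
qed

end

(* Let m be the number of edges and R the Randic index. The test vector with entries sqrt d_v shows,
   by the arithmetic-geometric mean inequality over the edges, that some eigenvalue mu satisfies
   m <= R mu. Since the squares of all eigenvalues sum to 2m, this gives
   s^- <= 2m - mu^2 <= 2 R mu - mu^2 <= R^2.
   In case of equality mu = R and mu is the only positive eigenvalue; the trace is 0 and the squares
   of the negative eigenvalues sum to mu^2, so -mu is the only negative one. Thus the adjacency matrix
   is mu (f f^T - g g^T), its zero diagonal forces g_v = f_v or g_v = - f_v, and the sign is the
   bipartition. Conversely, for K_{p,q} the test vector with entries sqrt d_v on one side and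
   - sqrt d_v on the other yields an eigenvalue that is at most - sqrt (pq) = - R. *)

theory Submission
  imports Defs "Jordan_Normal_Form.Spectral_Radius"
begin

section \<open>The spectral theorem for real symmetric matrices\<close>

text \<open>An eigenvalue \<open>z\<close> exists over the complex numbers. Symmetry makes the
  Hermitian form \<open>S\<close> of its eigenvector equal to its own conjugate, and
  \<open>S = z * N\<close> with \<open>N\<close> real and nonzero, so \<open>z\<close> is real and
  hence a root of the real characteristic polynomial.\<close>

lemma symmetric_real_eigenvector_exists:
  fixes A :: "real mat"
  assumes A: "A \<in> carrier_mat n n" and sym: "A\<^sup>T = A" and n: "0 < n"
  obtains v e where "eigenvector A v e"
proof -
  define C where "C = map_mat complex_of_real A"
  have C: "C \<in> carrier_mat n n"
    using A by (simp add: C_def)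
  obtain z where z: "eigenvalue C z"
    using spectrum_non_empty[OF C] n by (auto simp: spectrum_def)
  then obtain v where "eigenvector C v z"
    by (auto simp: eigenvalue_def)
  then have v: "v \<in> carrier_vec n" "v \<noteq> 0\<^sub>v n" and Cv: "C *\<^sub>v v = z \<cdot>\<^sub>v v"
    using C by (auto simp: eigenvector_def)
  have Csym: "cnj (C $$ (i, j)) = C $$ (j, i)" if "i < n" "j < n" for i j
  proof -
    have "A\<^sup>T $$ (i, j) = A $$ (i, j)"
      by (simp add: sym)
    then show ?thesis
      using that A by (simp add: C_def)
  qed
  define N where "N = (\<Sum>i<n. v $ i * cnj (v $ i))"
  define S where "S = (\<Sum>i<n. \<Sum>j<n. C $$ (i, j) * v $ j * cnj (v $ i))"
  have "v \<bullet>c v \<noteq> 0"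
    using conjugate_square_eq_0_vec[OF v(1)] v(2) by simp
  then have N0: "N \<noteq> 0"
    using v by (simp add: N_def scalar_prod_def lessThan_atLeast0)
  have "(\<Sum>j<n. C $$ (i, j) * v $ j) = z * v $ i" if "i < n" for i
  proof -
    have "(C *\<^sub>v v) $ i = (\<Sum>j<n. C $$ (i, j) * v $ j)"
      using that C v by (simp add: scalar_prod_def lessThan_atLeast0)
    then show ?thesis
      using that v by (simp add: Cv)
  qed
  then have "S = (\<Sum>i<n. z * v $ i * cnj (v $ i))"
    unfolding S_def sum_distrib_right[symmetric] by (intro sum.cong) auto
  then have SN: "S = z * N"
    by (simp add: N_def sum_distrib_left mult.assoc)
  have "cnj S = (\<Sum>i<n. \<Sum>j<n. C $$ (j, i) * cnj (v $ j) * v $ i)"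
    unfolding S_def cnj_sum by (intro sum.cong refl) (use Csym in auto)
  also have "\<dots> = S"
    unfolding S_def by (subst sum.swap) (rule sum.cong[OF refl], rule sum.cong[OF refl], simp)
  finally have "cnj z * cnj N = z * N"
    unfolding SN by simp
  moreover have "cnj N = N"
    by (simp add: N_def mult.commute)
  ultimately have "cnj z = z"
    using N0 by simp
  then obtain r where r: "z = complex_of_real r"
    by (metis Reals_cases Reals_cnj_iff)
  have "poly (map_poly complex_of_real (char_poly A)) (complex_of_real r) = 0"
    using z eigenvalue_root_char_poly[OF C, of z] of_real_hom.char_poly_hom[OF A, where 'a=complex]
    by (simp add: C_def r)
  then have "eigenvalue A r"
    by (simp add: eigenvalue_root_char_poly[OF A])
  then show ?thesis
    using that by (auto simp: eigenvalue_def)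
qed

text \<open>Gram-Schmidt leaves the first vector of a basis unchanged, so it is applied to a basis
  that starts with \<open>v\<close>.\<close>

lemma corthogonal_basis_completion:
  fixes v :: "'a :: conjugatable_ordered_field vec"
  assumes v: "v \<in> carrier_vec n" "v \<noteq> 0\<^sub>v n"
  obtains ws where "set ws \<subseteq> carrier_vec n" "corthogonal ws" "length ws = n" "hd ws = v"
proof -
  interpret cof_vec_space n "TYPE('a)" .
  define b where "b = basis_completion v"
  note b = basis_completion[OF v, folded b_def]
  have n: "n \<noteq> 0"
    using v by auto
  obtain vs where bv: "b = v # vs"
    using b(6,7) n by (cases b) auto
  note g = gram_schmidt_result[OF b(2) b(4) b(5) refl]
  show ?thesis
  proof (rule that)
    show "set (gram_schmidt n b) \<subseteq> carrier_vec n" "corthogonal (gram_schmidt n b)"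
      by (fact g)+
    show "length (gram_schmidt n b) = n"
      using g(4) b(6) by simp
    show "hd (gram_schmidt n b) = v"
      using gram_schmidt_hd[OF v(1), of vs] by (simp add: bv)
  qed
qed

lemma orthogonal_mat_first_col:
  fixes v :: "real vec"
  assumes v: "v \<in> carrier_vec n" "v \<noteq> 0\<^sub>v n"
  obtains W c where "W \<in> carrier_mat n n" "W\<^sup>T * W = 1\<^sub>m n" "col W 0 = c \<cdot>\<^sub>v v"
proof -
  obtain ws where ws: "set ws \<subseteq> carrier_vec n" "corthogonal ws" "length ws = n" and hdws: "hd ws = v"
    using corthogonal_basis_completion[OF v] by metis
  define c where "c w = 1 / sqrt (w \<bullet> w)" for w :: "real vec"
  define W where "W = mat_of_cols n (map (\<lambda>w. c w \<cdot>\<^sub>v w) ws)"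
  have n: "n \<noteq> 0"
    using v by auto
  have wc: "ws ! i \<in> carrier_vec n" if "i < n" for i
    using ws that by auto
  have colW: "col W i = c (ws ! i) \<cdot>\<^sub>v (ws ! i)" if "i < n" for i
    using wc[OF that] that ws by (simp add: W_def)
  have W: "W \<in> carrier_mat n n"
    using ws by (simp add: W_def mat_of_cols_def)
  have orth: "ws ! i \<bullet> ws ! j = 0 \<longleftrightarrow> i \<noteq> j" if "i < n" "j < n" for i j
    using corthogonalD[OF ws(2), of i j] that ws(3) wc by simp
  have unit: "c (ws ! i) * (c (ws ! i) * (ws ! i \<bullet> ws ! i)) = 1" if "i < n" for i
  proof -
    have "ws ! i \<bullet> ws ! i \<ge> 0"
      by (simp add: scalar_prod_def sum_nonneg)
    then show ?thesis
      using orth[OF that that] by (simp add: c_def)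
  qed
  have "W\<^sup>T * W = 1\<^sub>m n"
  proof (rule eq_matI)
    fix i j
    assume "i < dim_row (1\<^sub>m n :: real mat)" "j < dim_col (1\<^sub>m n :: real mat)"
    then have ij: "i < n" "j < n"
      by auto
    then have "(W\<^sup>T * W) $$ (i, j) = c (ws ! i) * (c (ws ! j) * (ws ! i \<bullet> ws ! j))"
      using W smult_scalar_prod_distrib[OF wc wc] scalar_prod_smult_distrib[OF smult_carrier_vec[THEN iffD2, OF wc] wc]
      by (simp add: colW)
    also have "\<dots> = 1\<^sub>m n $$ (i, j)"
      using ij orth[OF ij] unit by simp
    finally show "(W\<^sup>T * W) $$ (i, j) = 1\<^sub>m n $$ (i, j)" .
  qed (use W in auto)
  moreover have "v = ws ! 0"
    using hdws n ws(3) by (cases ws) auto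
  then have "col W 0 = c v \<cdot>\<^sub>v v"
    using colW n by simp
  ultimately show ?thesis
    using W by (intro that)
qed

text \<open>Deflation: an orthogonal change of basis whose first vector is an eigenvector splits off
  a 1 x 1 block. The complementary block is again symmetric, so the induction hypothesis
  diagonalizes it.\<close>

lemma symmetric_mat_orthogonally_diagonalizable:
  fixes A :: "real mat"
  assumes "A \<in> carrier_mat n n" and "A\<^sup>T = A"
  shows "\<exists>U f. U \<in> carrier_mat n n \<and> U\<^sup>T * U = 1\<^sub>m n \<and> U\<^sup>T * A * U = mat_diag n f"
  using assms
proof (induction n arbitrary: A)
  case 0
  then have "A = mat_diag 0 (\<lambda>_. 0)"
    by (intro eq_matI) (auto simp: mat_diag_def)
  then show ?case
    by (intro exI[of _ "1\<^sub>m 0"]) (auto simp: left_mult_one_mat[OF mat_diag_dim] right_mult_one_mat[OF mat_diag_dim])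
next
  case (Suc m)
  note A = Suc.prems(1) and sym = Suc.prems(2)
  obtain v e where "eigenvector A v e"
    using symmetric_real_eigenvector_exists[OF A sym] by auto
  then have v: "v \<in> carrier_vec (Suc m)" "v \<noteq> 0\<^sub>v (Suc m)" and Av: "A *\<^sub>v v = e \<cdot>\<^sub>v v"
    using A by (auto simp: eigenvector_def)
  obtain W c where W: "W \<in> carrier_mat (Suc m) (Suc m)" "W\<^sup>T * W = 1\<^sub>m (Suc m)"
    and W0: "col W 0 = c \<cdot>\<^sub>v v"
    using orthogonal_mat_first_col[OF v] .
  define B where "B = W\<^sup>T * A * W"
  have B: "B \<in> carrier_mat (Suc m) (Suc m)"
    using W A by (simp add: B_def)
  have Bsym: "B\<^sup>T = B"
    using W(1) A sym by (simp add: B_def transpose_mult[of _ "Suc m" "Suc m" _ "Suc m"] assoc_mult_mat[of _ "Suc m" "Suc m" _ "Suc m" _ "Suc m"])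
  \<comment> \<open>The first column of \<open>W\<close> is an eigenvector and the columns are
    orthonormal, so the first column of \<open>B\<close> is \<open>e\<close> times the first unit
    vector; by symmetry the same holds for the first row.\<close>
  have B0: "B $$ (i, 0) = (if i = 0 then e else 0)" if "i < Suc m" for i
  proof -
    have "B $$ (i, 0) = col W i \<bullet> (A *\<^sub>v col W 0)"
    proof -
      have "B = W\<^sup>T * (A * W)"
        using W A by (simp add: B_def assoc_mult_mat[of _ "Suc m" "Suc m" _ "Suc m" _ "Suc m"])
      then show ?thesis
        using that W A by (simp add: mult_mat_vec_def)
    qed
    also have "A *\<^sub>v col W 0 = e \<cdot>\<^sub>v col W 0"
      using A v Av by (simp add: W0 mult_mat_vec smult_smult_assoc mult.commute)
    also have "col W i \<bullet> (e \<cdot>\<^sub>v col W 0) = e * (W\<^sup>T * W) $$ (i, 0)"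
      using that W(1) by (simp add: scalar_prod_smult_distrib[of _ "Suc m"])
    also have "\<dots> = (if i = 0 then e else 0)"
      using that by (simp add: W(2))
    finally show ?thesis .
  qed
  have Bij: "B $$ (i, j) = B $$ (j, i)" if "i < Suc m" "j < Suc m" for i j
  proof -
    have "B\<^sup>T $$ (j, i) = B $$ (j, i)"
      by (simp add: Bsym)
    then show ?thesis
      using that B by simp
  qed
  define C where "C = mat m m (\<lambda>(i, j). B $$ (Suc i, Suc j))"
  have C: "C \<in> carrier_mat m m"
    by (simp add: C_def)
  have "C\<^sup>T = C"
    by (rule eq_matI) (auto simp: C_def Bij)
  with Suc.IH[OF C] obtain V f where V: "V \<in> carrier_mat m m" "V\<^sup>T * V = 1\<^sub>m m"
    and VCV: "V\<^sup>T * C * V = mat_diag m f"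
    by blast
  define E where "E = mat 1 1 (\<lambda>_. e)"
  have E: "E \<in> carrier_mat 1 1"
    by (simp add: E_def)
  \<comment> \<open>\<open>X\<close> fixes the split-off coordinate and acts by \<open>V\<close> on
    the rest; \<open>W * X\<close> is the orthogonal matrix sought.\<close>
  define X where "X = four_block_mat (1\<^sub>m 1) (0\<^sub>m 1 m) (0\<^sub>m m 1) V"
  have X: "X \<in> carrier_mat (Suc m) (Suc m)"
    using four_block_carrier_mat[OF one_carrier_mat V(1), of 1] by (simp add: X_def)
  have XT: "X\<^sup>T = four_block_mat (1\<^sub>m 1) (0\<^sub>m 1 m) (0\<^sub>m m 1) V\<^sup>T"
    using V unfolding X_def by (subst transpose_four_block_mat[of _ 1 1 _ m _ m]) auto
  have Bblock: "B = four_block_mat E (0\<^sub>m 1 m) (0\<^sub>m m 1) C"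
    using B B0 Bij[of 0] by (intro eq_matI) (auto simp: E_def C_def)
  have XX: "X\<^sup>T * X = 1\<^sub>m (Suc m)"
    unfolding XT unfolding X_def
    using V four_block_one_mat[of 1 m]
    by (subst mult_four_block_mat[of _ 1 1 _ m _ m _ _ 1 _ m]) auto
  have XBX: "X\<^sup>T * B * X = four_block_mat E (0\<^sub>m 1 m) (0\<^sub>m m 1) (mat_diag m f)"
  proof -
    have "X\<^sup>T * B = four_block_mat E (0\<^sub>m 1 m) (0\<^sub>m m 1) (V\<^sup>T * C)"
      unfolding XT Bblock using V C E
      by (subst mult_four_block_mat[of _ 1 1 _ m _ m _ _ 1 _ m]) auto
    then have "X\<^sup>T * B * X = four_block_mat E (0\<^sub>m 1 m) (0\<^sub>m m 1) (V\<^sup>T * C * V)"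
      unfolding X_def using V C E
      by (simp, subst mult_four_block_mat[of _ 1 1 _ m _ m _ _ 1 _ m]) auto
    then show ?thesis
      by (simp add: VCV)
  qed
  have D: "X\<^sup>T * B * X = mat_diag (Suc m) (case_nat e f)"
    unfolding XBX by (rule eq_matI) (auto simp: E_def mat_diag_def split: nat.split)
  have T: "(W * X)\<^sup>T = X\<^sup>T * W\<^sup>T"
    using W X by (simp add: transpose_mult)
  have "(W * X)\<^sup>T * (W * X) = X\<^sup>T * (W\<^sup>T * W) * X"
    unfolding T using W(1) X by (simp add: assoc_mult_mat[of _ "Suc m" "Suc m" _ "Suc m" _ "Suc m"])
  then have 1: "(W * X)\<^sup>T * (W * X) = 1\<^sub>m (Suc m)"
    using X XX by (simp add: W(2))
  have "(W * X)\<^sup>T * A * (W * X) = X\<^sup>T * B * X"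
    unfolding T B_def using W(1) X A by (simp add: assoc_mult_mat[of _ "Suc m" "Suc m" _ "Suc m" _ "Suc m"])
  with 1 D W(1) X show ?case
    by (metis mult_carrier_mat)
qed

text \<open>Matrix indices are traded for elements of \<open>vs\<close>: \<open>u k\<close> is the
  \<open>k\<close>-th column of the orthogonal matrix, read as a function. Orthonormality of columns
  and of rows is recorded separately, since both are used later.\<close>

lemma spectral_decomposition:
  fixes M :: "'a \<Rightarrow> 'a \<Rightarrow> real"
  assumes vs: "distinct vs" and sym: "\<And>v w. M v w = M w v"
  defines "n \<equiv> length vs"
  obtains lam u where
    "char_poly (mat n n (\<lambda>(i, j). M (vs ! i) (vs ! j))) = (\<Prod>k<n. [:- lam k, 1:])"
    "\<And>k l. k < n \<Longrightarrow> l < n \<Longrightarrow> (\<Sum>v\<in>set vs. u k v * u l v) = (if k = l then 1 else 0)"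
    "\<And>v w. v \<in> set vs \<Longrightarrow> w \<in> set vs \<Longrightarrow> (\<Sum>k<n. u k v * u k w) = (if v = w then 1 else 0)"
    "\<And>v w. v \<in> set vs \<Longrightarrow> w \<in> set vs \<Longrightarrow> M v w = (\<Sum>k<n. lam k * u k v * u k w)"
proof -
  define A where "A = mat n n (\<lambda>(i, j). M (vs ! i) (vs ! j))"
  have A: "A \<in> carrier_mat n n"
    by (simp add: A_def)
  have "A\<^sup>T = A"
    by (rule eq_matI) (auto simp: A_def intro: sym)
  then obtain U f where U: "U \<in> carrier_mat n n" and UU: "U\<^sup>T * U = 1\<^sub>m n"
    and D: "U\<^sup>T * A * U = mat_diag n f"
    using symmetric_mat_orthogonally_diagonalizable[OF A] by blast
  have UT: "U\<^sup>T \<in> carrier_mat n n"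
    using U by simp
  have UU': "U * U\<^sup>T = 1\<^sub>m n"
    using mat_mult_left_right_inverse[OF UT U UU] .
  note assoc = assoc_mult_mat[of _ n n _ n _ n]
  have "U * (U\<^sup>T * A * U) * U\<^sup>T = (U * U\<^sup>T) * A * (U * U\<^sup>T)"
    using U UT A by (simp add: assoc)
  then have AD: "A = U * mat_diag n f * U\<^sup>T"
    using A by (simp add: UU' D)
  have "similar_mat A (mat_diag n f)"
    using similar_mat_witI[OF UU' UU AD A mat_diag_dim U UT] by (auto simp: similar_mat_def)
  then have "char_poly A = char_poly (mat_diag n f)"
    by (rule char_poly_similar)
  also have "\<dots> = (\<Prod>a\<leftarrow>diag_mat (mat_diag n f). [:- a, 1:])"
    by (rule char_poly_upper_triangular[OF mat_diag_dim]) (auto simp: mat_diag_def)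
  also have "diag_mat (mat_diag n f) = map f [0..<n]"
    by (auto simp: diag_mat_def mat_diag_def)
  also have "(\<Prod>a\<leftarrow>map f [0..<n]. [:- a, 1:]) = (\<Prod>k<n. [:- f k, 1:])"
    by (simp add: prod.distinct_set_conv_list[symmetric] o_def lessThan_atLeast0)
  finally have cp: "char_poly A = (\<Prod>k<n. [:- f k, 1:])" .
  have bij: "bij_betw ((!) vs) {..<n} (set vs)"
    using vs by (intro bij_betw_nth) (auto simp: n_def)
  \<comment> \<open>\<open>ix\<close> sends an element of \<open>vs\<close> back to its row
    number.\<close>
  define ix where "ix = the_inv_into {..<n} ((!) vs)"
  have ix: "ix (vs ! i) = i" if "i < n" for i
    using the_inv_into_f_f[OF bij_betw_imp_inj_on[OF bij]] that by (simp add: ix_def)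
  have mem: "\<exists>i<n. v = vs ! i" if "v \<in> set vs" for v
    using that by (metis in_set_conv_nth n_def)
  have eq: "vs ! i = vs ! j \<longleftrightarrow> i = j" if "i < n" "j < n" for i j
    using vs that by (simp add: n_def nth_eq_iff_index_eq)
  define u where "u k v = U $$ (ix v, k)" for k v
  show thesis
  proof (rule that[of f u])
    show "char_poly (mat n n (\<lambda>(i, j). M (vs ! i) (vs ! j))) = (\<Prod>k<n. [:- f k, 1:])"
      using cp by (simp add: A_def)
  next
    fix k l
    assume kl: "k < n" "l < n"
    have "(\<Sum>v\<in>set vs. u k v * u l v) = (\<Sum>i<n. u k (vs ! i) * u l (vs ! i))"
      by (rule sum.reindex_bij_betw[OF bij, symmetric])
    also have "\<dots> = (\<Sum>i<n. U $$ (i, k) * U $$ (i, l))"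
      by (simp add: u_def ix)
    also have "\<dots> = (U\<^sup>T * U) $$ (k, l)"
      using U kl by (simp add: scalar_prod_def lessThan_atLeast0)
    finally show "(\<Sum>v\<in>set vs. u k v * u l v) = (if k = l then 1 else 0)"
      using kl by (simp add: UU)
  next
    fix v w
    assume "v \<in> set vs" "w \<in> set vs"
    then obtain i j where ij: "i < n" "v = vs ! i" "j < n" "w = vs ! j"
      using mem by blast
    have "(\<Sum>k<n. u k v * u k w) = (U * U\<^sup>T) $$ (i, j)"
      using U ij by (simp add: scalar_prod_def lessThan_atLeast0 u_def ix)
    then show "(\<Sum>k<n. u k v * u k w) = (if v = w then 1 else 0)"
      using ij by (simp add: UU' eq)
    have "A $$ (i, j) = (\<Sum>k<n. (U * mat_diag n f) $$ (i, k) * U $$ (j, k))"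
      unfolding AD using U ij carrier_matD[OF mat_diag_dim, of n f]
      by (simp add: scalar_prod_def lessThan_atLeast0)
    also have "\<dots> = (\<Sum>k<n. f k * u k v * u k w)"
      using U ij by (simp add: mat_diag_mult_right[OF U] u_def ix mult.commute)
    finally show "M v w = (\<Sum>k<n. f k * u k v * u k w)"
      using ij by (simp add: A_def)
  qed
qed

section \<open>Quadratic forms in a basis of eigenvectors\<close>

text \<open>The matrix and its eigenvalues are parameters apart from the basis, so that the same
  basis can be reused for the identity (Parseval) and for \<open>- M\<close> (upper bounds on the
  least eigenvalue).\<close>

locale spectral_form =
  fixes V :: "'a set" and n :: nat and M :: "'a \<Rightarrow> 'a \<Rightarrow> real"
    and lam :: "nat \<Rightarrow> real" and u :: "nat \<Rightarrow> 'a \<Rightarrow> real"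
  assumes finite_V: "finite V"
    and orthonormal: "\<And>k l. k < n \<Longrightarrow> l < n \<Longrightarrow> (\<Sum>v\<in>V. u k v * u l v) = (if k = l then 1 else 0)"
    and complete: "\<And>v w. v \<in> V \<Longrightarrow> w \<in> V \<Longrightarrow> (\<Sum>k<n. u k v * u k w) = (if v = w then 1 else 0)"
    and expansion: "\<And>v w. v \<in> V \<Longrightarrow> w \<in> V \<Longrightarrow> M v w = (\<Sum>k<n. lam k * u k v * u k w)"
begin

lemma quadratic_form:
  "(\<Sum>v\<in>V. \<Sum>w\<in>V. M v w * x v * x w) = (\<Sum>k<n. lam k * (\<Sum>v\<in>V. u k v * x v)\<^sup>2)"
proof -
  have "(\<Sum>v\<in>V. \<Sum>w\<in>V. M v w * x v * x w)
      = (\<Sum>v\<in>V. \<Sum>w\<in>V. \<Sum>k<n. lam k * ((u k v * x v) * (u k w * x w)))"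
    by (intro sum.cong refl) (simp add: expansion sum_distrib_right sum_distrib_left ac_simps)
  also have "\<dots> = (\<Sum>v\<in>V. \<Sum>k<n. \<Sum>w\<in>V. lam k * ((u k v * x v) * (u k w * x w)))"
    by (intro sum.cong refl sum.swap)
  also have "\<dots> = (\<Sum>k<n. \<Sum>v\<in>V. \<Sum>w\<in>V. lam k * ((u k v * x v) * (u k w * x w)))"
    by (rule sum.swap)
  also have "\<dots> = (\<Sum>k<n. lam k * (\<Sum>v\<in>V. u k v * x v)\<^sup>2)"
    unfolding power2_eq_square sum_product by (simp add: sum_distrib_left)
  finally show ?thesis .
qed

text \<open>The identity matrix has the same eigenbasis with all eigenvalues 1, so this is a case of
  \<open>quadratic_form\<close>.\<close>

lemma parseval: "(\<Sum>v\<in>V. (x v)\<^sup>2) = (\<Sum>k<n. (\<Sum>v\<in>V. u k v * x v)\<^sup>2)"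
proof -
  interpret I: spectral_form V n "\<lambda>v w. if v = w then 1 else 0" "\<lambda>_. 1" u
    by unfold_locales (auto simp: finite_V orthonormal complete)
  have "(\<Sum>v\<in>V. (x v)\<^sup>2) = (\<Sum>v\<in>V. \<Sum>w\<in>V. (if v = w then 1 else 0) * x v * x w)"
    by (intro sum.cong refl) (simp add: finite_V power2_eq_square if_distrib[of "\<lambda>c. c * _"] cong: if_cong)
  also have "\<dots> = (\<Sum>k<n. (\<Sum>v\<in>V. u k v * x v)\<^sup>2)"
    unfolding I.quadratic_form by simp
  finally show ?thesis .
qed

lemma trace: "(\<Sum>v\<in>V. M v v) = (\<Sum>k<n. lam k)"
proof -
  have "(\<Sum>v\<in>V. M v v) = (\<Sum>k<n. \<Sum>v\<in>V. lam k * (u k v * u k v))"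
    by (subst sum.swap) (simp add: expansion mult.assoc)
  also have "\<dots> = (\<Sum>k<n. lam k)"
    by (simp add: orthonormal flip: sum_distrib_left)
  finally show ?thesis .
qed

text \<open>Only one factor of each square is expanded; what multiplies \<open>lam k\<close> is then
  the quadratic form at the unit eigenvector \<open>u k\<close>, which is \<open>lam k\<close>
  again.\<close>

lemma sum_squares: "(\<Sum>v\<in>V. \<Sum>w\<in>V. (M v w)\<^sup>2) = (\<Sum>k<n. (lam k)\<^sup>2)"
proof -
  have "(\<Sum>v\<in>V. \<Sum>w\<in>V. (M v w)\<^sup>2) = (\<Sum>v\<in>V. \<Sum>w\<in>V. \<Sum>k<n. lam k * (M v w * u k v * u k w))"
  proof (intro sum.cong refl)
    fix v w
    assume "v \<in> V" "w \<in> V"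
    then have "(M v w)\<^sup>2 = M v w * (\<Sum>k<n. lam k * u k v * u k w)"
      using expansion by (simp add: power2_eq_square)
    then show "(M v w)\<^sup>2 = (\<Sum>k<n. lam k * (M v w * u k v * u k w))"
      by (simp add: sum_distrib_left ac_simps)
  qed
  also have "\<dots> = (\<Sum>v\<in>V. \<Sum>k<n. \<Sum>w\<in>V. lam k * (M v w * u k v * u k w))"
    by (intro sum.cong refl sum.swap)
  also have "\<dots> = (\<Sum>k<n. lam k * (\<Sum>v\<in>V. \<Sum>w\<in>V. M v w * u k v * u k w))"
    by (subst sum.swap) (simp add: sum_distrib_left)
  also have "\<dots> = (\<Sum>k<n. (lam k)\<^sup>2)"
  proof (rule sum.cong[OF refl])
    fix k
    assume k: "k \<in> {..<n}"
    have "(\<Sum>l<n. lam l * (\<Sum>v\<in>V. u l v * u k v)\<^sup>2) = (\<Sum>l<n. if l = k then lam l else 0)"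
      using k by (intro sum.cong) (auto simp: orthonormal)
    then show "lam k * (\<Sum>v\<in>V. \<Sum>w\<in>V. M v w * u k v * u k w) = (lam k)\<^sup>2"
      using k unfolding quadratic_form by (simp add: power2_eq_square)
  qed
  finally show ?thesis .
qed

text \<open>Rayleigh principle: if all eigenvalues were below \<open>c\<close>, a sum of nonnegative
  terms would be at most 0, so all coefficients of \<open>x\<close> in the eigenbasis would vanish,
  against Parseval.\<close>

lemma ex_eigenvalue_ge:
  assumes le: "c * (\<Sum>v\<in>V. (x v)\<^sup>2) \<le> (\<Sum>v\<in>V. \<Sum>w\<in>V. M v w * x v * x w)"
    and pos: "0 < (\<Sum>v\<in>V. (x v)\<^sup>2)"
  shows "\<exists>k<n. c \<le> lam k"
proof (rule ccontr)
  assume "\<not> ?thesis"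
  then have less: "lam k < c" if "k < n" for k
    using that by auto
  define y where "y k = (\<Sum>v\<in>V. u k v * x v)" for k
  have "(\<Sum>k<n. (c - lam k) * (y k)\<^sup>2) \<le> 0"
    using le unfolding quadratic_form parseval
    by (simp add: y_def left_diff_distrib sum_subtractf sum_distrib_left)
  moreover have nonneg: "0 \<le> (c - lam k) * (y k)\<^sup>2" if "k < n" for k
    using less[OF that] by simp
  ultimately have "(\<Sum>k<n. (c - lam k) * (y k)\<^sup>2) = 0"
    by (intro antisym sum_nonneg) auto
  then have "(c - lam k) * (y k)\<^sup>2 = 0" if "k < n" for k
    using that nonneg by (subst (asm) sum_nonneg_eq_0_iff) auto
  then have "y k = 0" if "k < n" for k
    using that less[OF that] by auto
  then show False
    using pos unfolding parseval by (simp add: y_def)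
qed

lemma ex_eigenvalue_le:
  assumes le: "(\<Sum>v\<in>V. \<Sum>w\<in>V. M v w * x v * x w) \<le> c * (\<Sum>v\<in>V. (x v)\<^sup>2)"
    and pos: "0 < (\<Sum>v\<in>V. (x v)\<^sup>2)"
  shows "\<exists>k<n. lam k \<le> c"
proof -
  interpret neg: spectral_form V n "\<lambda>v w. - M v w" "\<lambda>k. - lam k" u
    by unfold_locales (auto simp: finite_V orthonormal complete expansion sum_negf)
  show ?thesis
    using neg.ex_eigenvalue_ge[of "- c" x] assms by (simp add: sum_negf)
qed

end

section \<open>Adjacency spectrum and Randic index\<close>

definition adj :: "('a, 'b) pre_digraph \<Rightarrow> 'a \<Rightarrow> 'a \<Rightarrow> real" where
  "adj G v w = (if (v, w) \<in> arcs_ends G then 1 else 0)"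

context graph
begin

section \<open>Arcs, degrees and the Randic index\<close>

lemma arcs_ends_subset: "arcs_ends G \<subseteq> verts G \<times> verts G"
  using adj_in_verts by auto

lemma finite_arcs_ends: "finite (arcs_ends G)"
  by (simp add: arcs_ends_def)

lemma sum_adj:
  "(\<Sum>v\<in>verts G. \<Sum>w\<in>verts G. adj G v w * f v w) = (\<Sum>(v, w)\<in>arcs_ends G. f v w)"
proof -
  have "(\<Sum>v\<in>verts G. \<Sum>w\<in>verts G. adj G v w * f v w)
      = (\<Sum>p\<in>verts G \<times> verts G. if p \<in> arcs_ends G then case p of (v, w) \<Rightarrow> f v w else 0)"
    unfolding sum.cartesian_product by (intro sum.cong) (auto simp: adj_def)
  also have "\<dots> = (\<Sum>p\<in>(verts G \<times> verts G) \<inter> arcs_ends G. case p of (v, w) \<Rightarrow> f v w)"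
    by (rule sum.inter_restrict[symmetric]) simp
  also have "(verts G \<times> verts G) \<inter> arcs_ends G = arcs_ends G"
    using arcs_ends_subset by blast
  finally show ?thesis .
qed

lemma out_degree_eq_card: "out_degree G v = card {w \<in> verts G. (v, w) \<in> arcs_ends G}"
proof -
  have "inj_on (head G) (out_arcs G v)"
    by (intro inj_onI no_multi_arcs) (auto simp: arc_to_ends_def)
  moreover have "head G ` out_arcs G v = {w \<in> verts G. (v, w) \<in> arcs_ends G}"
    by (auto simp: arcs_ends_conv)
  ultimately show ?thesis
    unfolding out_degree_def by (metis card_image)
qed

lemma sum_out_degree: "(\<Sum>v\<in>verts G. real (out_degree G v)) = card (arcs_ends G)"
  using sum_adj[of "\<lambda>_ _. 1"] by (simp add: out_degree_eq_card adj_def sum.If_cases Int_def)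

lemma out_degree_pos: "(v, w) \<in> arcs_ends G \<Longrightarrow> 0 < out_degree G v"
  unfolding out_degree_def by (auto simp: card_gt_0_iff finite_out_arcs arcs_ends_conv)

text \<open>Every undirected edge comes from exactly two opposite arcs, whence the factor 2.\<close>

lemma randic_index_arcs:
  "2 * randic_index G = (\<Sum>(v, w)\<in>arcs_ends G. 1 / sqrt (real (out_degree G v) * real (out_degree G w)))"
proof -
  let ?f = "\<lambda>(v, w). {v, w}" and ?d = "\<lambda>v. real (out_degree G v)"
  let ?g = "\<lambda>(v, w). 1 / sqrt (?d v * ?d w)"
  have "sum ?g (arcs_ends G) = (\<Sum>e\<in>undirected_edges G. \<Sum>p\<in>{p \<in> arcs_ends G. ?f p = e}. ?g p)"
    unfolding undirected_edges_def by (rule sum.image_gen) (rule finite_arcs_ends)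
  also have "\<dots> = (\<Sum>e\<in>undirected_edges G. 2 * (1 / sqrt (\<Prod>v\<in>e. ?d v)))"
  proof (rule sum.cong[OF refl])
    fix e
    assume "e \<in> undirected_edges G"
    then obtain v w where vw: "(v, w) \<in> arcs_ends G" and e: "e = {v, w}"
      by (auto simp: undirected_edges_def)
    have "v \<noteq> w"
      using vw adj_not_same by auto
    moreover have "{p \<in> arcs_ends G. ?f p = e} = {(v, w), (w, v)}"
      using vw graph_symmetric by (auto simp: e doubleton_eq_iff)
    ultimately show "sum ?g {p \<in> arcs_ends G. ?f p = e} = 2 * (1 / sqrt (\<Prod>v\<in>e. ?d v))"
      by (simp add: e mult.commute)
  qed
  finally show ?thesis
    by (simp add: randic_index_def sum_distrib_left)
qed

text \<open>The root multiset of the characteristic polynomial becomes an indexed family, so the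
  eigenvalues in \<open>s_minus\<close> are the ones belonging to the eigenbasis.\<close>

lemma adjacency_spectrum:
  obtains n lam u where "spectral_form (verts G) n (adj G) lam u"
    and "s_minus G = (\<Sum>k\<in>{k. k < n \<and> lam k < 0}. (lam k)\<^sup>2)"
proof -
  define vs where "vs = vertex_list G"
  have vs: "distinct vs" "set vs = verts G"
    using vertex_list[of G] by (simp_all add: vs_def)
  have sym: "adj G v w = adj G w v" for v w
    using graph_symmetric by (auto simp: adj_def)
  obtain lam u where
    cp: "char_poly (mat (length vs) (length vs) (\<lambda>(i, j). adj G (vs ! i) (vs ! j))) = (\<Prod>k<length vs. [:- lam k, 1:])"
    and S: "\<And>k l. k < length vs \<Longrightarrow> l < length vs \<Longrightarrow> (\<Sum>v\<in>set vs. u k v * u l v) = (if k = l then 1 else 0)"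
      "\<And>v w. v \<in> set vs \<Longrightarrow> w \<in> set vs \<Longrightarrow> (\<Sum>k<length vs. u k v * u k w) = (if v = w then 1 else 0)"
      "\<And>v w. v \<in> set vs \<Longrightarrow> w \<in> set vs \<Longrightarrow> adj G v w = (\<Sum>k<length vs. lam k * u k v * u k w)"
    using spectral_decomposition[of vs "adj G", OF vs(1) sym] by blast
  have "graph_eigenvalues G = proots (\<Prod>k<length vs. [:- lam k, 1:])"
    using cp by (simp add: graph_eigenvalues_eq[OF vs] adjacency_mat_def adj_def)
  also have "\<dots> = (\<Sum>k<length vs. {#lam k#})"
    by (subst proots_prod) auto
  also have "\<dots> = image_mset lam (mset_set {..<length vs})"
    by (simp add: sum_unfold_sum_mset)
  finally have "s_minus G = (\<Sum>k\<in>{k \<in> {..<length vs}. lam k < 0}. (lam k)\<^sup>2)"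
    by (simp add: s_minus_def filter_mset_image_mset image_mset.compositionality o_def sum_unfold_sum_mset)
  moreover have "spectral_form (verts G) (length vs) (adj G) lam u"
    using S by unfold_locales (simp_all add: vs)
  ultimately show thesis
    using that by (simp add: conj_commute)
qed

section \<open>A lower bound for some eigenvalue\<close>

lemma randic_index_nonneg: "0 \<le> randic_index G"
  unfolding randic_index_def by (intro sum_nonneg divide_nonneg_nonneg) (auto intro: prod_nonneg)

lemma out_degree_mult_pos:
  assumes "(v, w) \<in> arcs_ends G"
  shows "0 < real (out_degree G v) * real (out_degree G w)"
  using out_degree_pos[OF assms] out_degree_pos[OF graph_symmetric[OF assms]] by simp

lemma randic_index_pos:
  assumes "arcs_ends G \<noteq> {}"
  shows "0 < randic_index G"
proof -
  have "0 < (\<Sum>(v, w)\<in>arcs_ends G. 1 / sqrt (real (out_degree G v) * real (out_degree G w)))"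
    using assms by (intro sum_pos finite_arcs_ends) (auto dest: out_degree_mult_pos)
  then show ?thesis
    by (simp flip: randic_index_arcs)
qed

lemma ex_eigenvalue_ge_edges_over_randic:
  assumes "spectral_form (verts G) n (adj G) lam u" and ne: "arcs_ends G \<noteq> {}"
  obtains a where "a < n" "card (arcs_ends G) \<le> 2 * randic_index G * lam a"
proof -
  interpret spectral_form "verts G" n "adj G" lam u
    by fact
  define N where "N = real (card (arcs_ends G))"
  define R where "R = randic_index G"
  \<comment> \<open>With \<open>N\<close> twice the number of edges, \<open>c\<close> is edges over
    Randic index, the bound to be reached. This choice makes
    \<open>2 * c * N - c\<^sup>2 * (2 * R)\<close> collapse to \<open>c * N\<close>.\<close>
  define c where "c = N / (2 * R)"
  define x where "x v = sqrt (real (out_degree G v))" for v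
  have R: "0 < R" and N: "0 < N"
    using randic_index_pos[OF ne] ne finite_arcs_ends by (auto simp: R_def N_def card_gt_0_iff)
  have norm: "(\<Sum>v\<in>verts G. (x v)\<^sup>2) = N"
    using sum_out_degree by (simp add: x_def N_def)
  \<comment> \<open>The arithmetic-geometric mean inequality for \<open>t\<close> and
    \<open>c\<^sup>2 / t\<close>. It is linear in \<open>1 / t\<close>, so summing it over the arcs
    produces the Randic index.\<close>
  have tangent: "2 * c - c\<^sup>2 * (1 / t) \<le> t" if "0 < t" for t
  proof -
    have "t - (2 * c - c\<^sup>2 * (1 / t)) = (t - c)\<^sup>2 / t"
      using that by (simp add: field_simps power2_eq_square)
    then show ?thesis
      using that by (metis diff_ge_0_iff_ge divide_nonneg_pos zero_le_power2)
  qed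
  have "2 * c - c\<^sup>2 * (1 / (x v * x w)) \<le> x v * x w" if "(v, w) \<in> arcs_ends G" for v w
    using out_degree_mult_pos[OF that] by (intro tangent) (simp add: x_def flip: real_sqrt_mult)
  then have "(\<Sum>(v, w)\<in>arcs_ends G. 2 * c - c\<^sup>2 * (1 / (x v * x w))) \<le> (\<Sum>(v, w)\<in>arcs_ends G. x v * x w)"
    by (intro sum_mono) auto
  moreover have "(\<Sum>(v, w)\<in>arcs_ends G. 2 * c - c\<^sup>2 * (1 / (x v * x w))) = 2 * c * N - c\<^sup>2 * (2 * R)"
    unfolding R_def randic_index_arcs
    by (simp add: case_prod_unfold sum_subtractf sum_distrib_left N_def x_def real_sqrt_mult)
  moreover have "2 * c * N - c\<^sup>2 * (2 * R) = c * N"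
    using R by (simp add: c_def power2_eq_square)
  moreover have "(\<Sum>(v, w)\<in>arcs_ends G. x v * x w) = (\<Sum>v\<in>verts G. \<Sum>w\<in>verts G. adj G v w * x v * x w)"
    using sum_adj[of "\<lambda>v w. x v * x w"] by (simp add: mult.assoc)
  ultimately have "c * (\<Sum>v\<in>verts G. (x v)\<^sup>2) \<le> (\<Sum>v\<in>verts G. \<Sum>w\<in>verts G. adj G v w * x v * x w)"
    by (simp add: norm)
  then obtain a where "a < n" "c \<le> lam a"
    using ex_eigenvalue_ge[of c x] N norm by auto
  moreover from this(2) have "N \<le> 2 * R * lam a"
    using R by (simp add: c_def field_simps)
  ultimately show thesis
    using that by (simp add: N_def R_def)
qed

section \<open>The inequality and the rank-two form forced by equality\<close>

lemma sum_squares_adj: "(\<Sum>v\<in>verts G. \<Sum>w\<in>verts G. (adj G v w)\<^sup>2) = card (arcs_ends G)"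
  using sum_adj[of "\<lambda>_ _. 1"] by (simp add: adj_def if_distrib[of "\<lambda>c. c\<^sup>2"] cong: if_cong)

lemma edgeless:
  assumes "arcs_ends G = {}"
  shows "s_minus G = 0" "randic_index G = 0"
proof -
  obtain n lam u where "spectral_form (verts G) n (adj G) lam u"
    and s: "s_minus G = (\<Sum>k\<in>{k. k < n \<and> lam k < 0}. (lam k)\<^sup>2)"
    by (rule adjacency_spectrum)
  then interpret spectral_form "verts G" n "adj G" lam u
    by simp
  have "(\<Sum>k<n. (lam k)\<^sup>2) = 0"
    using sum_squares sum_squares_adj assms by simp
  then have "\<forall>k<n. (lam k)\<^sup>2 = 0"
    by (subst (asm) sum_nonneg_eq_0_iff) auto
  then show "s_minus G = 0"
    unfolding s by (intro sum.neutral) auto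
  show "randic_index G = 0"
    using assms by (simp add: randic_index_def undirected_edges_def)
qed

text \<open>Both claims share one estimate: the first drops its slack terms, the second shows that
  they all vanish. The second conclusion keeps only a difference of two rank-one forms, so that the
  bipartition can be found without further spectral arguments.\<close>

lemma
  assumes ne: "arcs_ends G \<noteq> {}"
  shows s_minus_le_randic_index_sq: "s_minus G \<le> (randic_index G)\<^sup>2"
    and s_minus_eq_randic_index_sqD: "s_minus G = (randic_index G)\<^sup>2 \<Longrightarrow>
      \<exists>f g c. 0 < c \<and> (\<forall>v\<in>verts G. \<forall>w\<in>verts G. adj G v w = c * (f v * f w - g v * g w))"
proof -
  obtain n lam u where sf: "spectral_form (verts G) n (adj G) lam u"
    and s: "s_minus G = (\<Sum>k\<in>{k. k < n \<and> lam k < 0}. (lam k)\<^sup>2)"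
    by (rule adjacency_spectrum)
  interpret spectral_form "verts G" n "adj G" lam u
    by (fact sf)
  define R where "R = randic_index G"
  define N where "N = real (card (arcs_ends G))"
  define Neg where "Neg = {k. k < n \<and> lam k < 0}"
  obtain a where a: "a < n" and N_le: "N \<le> 2 * R * lam a"
    using ex_eigenvalue_ge_edges_over_randic[OF sf ne] by (auto simp: R_def N_def)
  have R: "0 < R" and N: "0 < N"
    using randic_index_pos[OF ne] ne finite_arcs_ends by (auto simp: R_def N_def card_gt_0_iff)
  have "0 < R * lam a"
    using N N_le by linarith
  then have pos: "0 < lam a"
    using R by (simp add: zero_less_mult_iff)
  have fin: "finite Neg"
    by (simp add: Neg_def)
  \<comment> \<open>\<open>Z\<close> holds the indices of the nonnegative eigenvalues other than
    \<open>a\<close>.\<close>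
  define Z where "Z = {..<n} - insert a Neg"
  have split: "sum f {..<n} = f a + sum f Neg + sum f Z" for f :: "nat \<Rightarrow> real"
  proof -
    have "insert a Neg \<subseteq> {..<n}" "a \<notin> Neg"
      using a pos by (auto simp: Neg_def)
    then show ?thesis
      using fin by (subst sum.subset_diff[of "insert a Neg"]) (auto simp: Z_def)
  qed
  have s': "s_minus G = (\<Sum>k\<in>Neg. (lam k)\<^sup>2)"
    by (simp add: s Neg_def)
  have total: "(lam a)\<^sup>2 + s_minus G + (\<Sum>k\<in>Z. (lam k)\<^sup>2) = N"
    using sum_squares sum_squares_adj split[of "\<lambda>k. (lam k)\<^sup>2"] by (simp add: N_def s')
  have Z: "0 \<le> (\<Sum>k\<in>Z. (lam k)\<^sup>2)"
    by (simp add: sum_nonneg)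
  have sq: "(R - lam a)\<^sup>2 = R\<^sup>2 - 2 * R * lam a + (lam a)\<^sup>2"
    by (simp add: power2_diff)
  then show "s_minus G \<le> (randic_index G)\<^sup>2"
    using total Z N_le zero_le_power2[of "R - lam a"] unfolding R_def[symmetric] by linarith
  assume "s_minus G = (randic_index G)\<^sup>2"
  then have eq: "s_minus G = R\<^sup>2"
    by (simp add: R_def)
  \<comment> \<open>The gap \<open>R\<^sup>2 - s_minus G\<close> is the sum of three nonnegative
    terms: this square, the sum over \<open>Z\<close>, and \<open>2 * R * lam a - N\<close>.\<close>
  have "(R - lam a)\<^sup>2 = 0" and Z0: "(\<Sum>k\<in>Z. (lam k)\<^sup>2) = 0"
    using eq sq total Z N_le zero_le_power2[of "R - lam a"] by linarith+
  then have lam_a: "lam a = R"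
    by simp
  have zero: "lam k = 0" if "k \<in> Z" for k
    using Z0 that by (subst (asm) sum_nonneg_eq_0_iff) (auto simp: Z_def)
  have "(\<Sum>v\<in>verts G. adj G v v) = 0"
    using adj_not_same by (intro sum.neutral) (auto simp: adj_def)
  then have sum_neg: "(\<Sum>k\<in>Neg. lam k) = - R"
    using trace split[of lam] zero lam_a by simp
  have bound: "- R \<le> lam k" if "k \<in> Neg" for k
  proof -
    have "(\<Sum>l\<in>Neg. lam l) \<le> (\<Sum>l\<in>{k}. lam l)"
      using that fin by (intro sum_mono2[of Neg "{k}" "\<lambda>l. - lam l", simplified sum_negf neg_le_iff_le]) (auto simp: Neg_def)
    then show ?thesis
      by (simp add: sum_neg)
  qed
  \<comment> \<open>The negative eigenvalues sum to \<open>- R\<close> and their squares sum to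
    \<open>R\<^sup>2\<close>, so these products, each nonnegative by \<open>bound\<close>, sum to 0.
    Hence every negative eigenvalue equals \<open>- R\<close>, and the sum leaves room for only
    one.\<close>
  have "(\<Sum>k\<in>Neg. (- lam k) * (R + lam k)) = - R * (\<Sum>k\<in>Neg. lam k) - (\<Sum>k\<in>Neg. (lam k)\<^sup>2)"
    unfolding sum_distrib_left sum_subtractf[symmetric]
    by (intro sum.cong) (auto simp: algebra_simps power2_eq_square)
  also have "\<dots> = 0"
    using eq unfolding s' sum_neg by (simp add: power2_eq_square)
  finally have "(\<Sum>k\<in>Neg. (- lam k) * (R + lam k)) = 0" .
  moreover have "0 \<le> (- lam k) * (R + lam k)" if "k \<in> Neg" for k
    using that bound[OF that] by (intro mult_nonneg_nonneg) (auto simp: Neg_def)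
  ultimately have "(- lam k) * (R + lam k) = 0" if "k \<in> Neg" for k
    using that fin by (subst (asm) sum_nonneg_eq_0_iff) auto
  then have neg: "lam k = - R" if "k \<in> Neg" for k
    using that by (fastforce simp: Neg_def)
  have "card Neg = 1"
    using sum_neg neg R by simp
  then obtain b where b: "Neg = {b}"
    by (auto simp: card_Suc_eq)
  have "adj G v w = R * (u a v * u a w - u b v * u b w)" if "v \<in> verts G" "w \<in> verts G" for v w
    using expansion[OF that] split[of "\<lambda>k. lam k * u k v * u k w"] b lam_a neg[of b] zero
    by (simp add: algebra_simps)
  then show "\<exists>f g c. 0 < c \<and> (\<forall>v\<in>verts G. \<forall>w\<in>verts G. adj G v w = c * (f v * f w - g v * g w))"
    using R by blast
qed

text \<open>The zero diagonal gives \<open>g v = f v\<close> or \<open>g v = - f v\<close>. Once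
  \<open>f\<close> is known to vanish nowhere, two vertices are adjacent exactly when their signs
  differ.\<close>

lemma complete_bipartite_if_rank_two:
  assumes c: "c \<noteq> 0"
    and adj: "\<And>v w. v \<in> verts G \<Longrightarrow> w \<in> verts G \<Longrightarrow> adj G v w = c * (f v * f w - g v * g w)"
    and nbr: "\<And>v. v \<in> verts G \<Longrightarrow> \<exists>w. (v, w) \<in> arcs_ends G"
  shows "\<exists>m n. complete_bipartite_digraph m n G"
proof -
  define U where "U = {v \<in> verts G. g v = f v}"
  define W where "W = verts G - U"
  have sq: "g v = f v \<or> g v = - f v" if "v \<in> verts G" for v
  proof -
    have "adj G v v = 0"
      using adj_not_same by (auto simp: adj_def)
    then have "(g v)\<^sup>2 = (f v)\<^sup>2"
      using adj[OF that that] c by (simp add: power2_eq_square)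
    then show ?thesis
      by (simp add: power2_eq_iff)
  qed
  \<comment> \<open>A zero of \<open>f\<close> would also be a zero of \<open>g\<close>, making the
    whole row of \<open>v\<close> zero although \<open>v\<close> has a neighbour.\<close>
  have nz: "f v \<noteq> 0" if v: "v \<in> verts G" for v
  proof
    assume "f v = 0"
    with sq[OF v] have "g v = 0"
      by auto
    obtain w where "(v, w) \<in> arcs_ends G"
      using nbr[OF v] by auto
    then have "w \<in> verts G" "adj G v w = 1"
      by (auto simp: adj_def dest: adj_in_verts)
    with adj[OF v] \<open>f v = 0\<close> \<open>g v = 0\<close> show False
      by simp
  qed
  have edge: "(v, w) \<in> arcs_ends G \<longleftrightarrow> (v \<in> U \<longleftrightarrow> w \<in> W)" if v: "v \<in> verts G" and w: "w \<in> verts G" for v w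
  proof -
    have "adj G v w = 0 \<longleftrightarrow> f v * f w = g v * g w"
      using adj[OF v w] c by simp
    then have "(v, w) \<in> arcs_ends G \<longleftrightarrow> f v * f w \<noteq> g v * g w"
      by (simp add: adj_def split: if_splits)
    moreover have "w \<in> W \<longleftrightarrow> w \<notin> U"
      using w by (simp add: W_def)
    moreover have "g z = (if z \<in> U then f z else - f z)" if "z \<in> verts G" for z
      using sq[OF that] that by (auto simp: U_def)
    then have "g v = (if v \<in> U then f v else - f v)" "g w = (if w \<in> U then f w else - f w)"
      using v w by blast+
    ultimately show ?thesis
      using nz[OF v] nz[OF w] by simp
  qed
  have "arcs_ends G = U \<times> W \<union> W \<times> U"
  proof (rule Set.set_eqI)
    fix p :: "'a \<times> 'a"
    obtain v w where p: "p = (v, w)"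
      by (cases p)
    have part: "z \<in> verts G \<longleftrightarrow> z \<in> U \<or> z \<in> W" "\<not> (z \<in> U \<and> z \<in> W)" for z
      by (auto simp: U_def W_def)
    show "p \<in> arcs_ends G \<longleftrightarrow> p \<in> U \<times> W \<union> W \<times> U"
      unfolding p using edge[of v w] arcs_ends_subset part[of v] part[of w] by blast
  qed
  moreover have "verts G = U \<union> W" "U \<inter> W = {}"
    by (auto simp: U_def W_def)
  ultimately have "complete_bipartite_digraph (card U) (card W) G"
    unfolding complete_bipartite_digraph_def using graph_axioms by blast
  then show ?thesis
    by blast
qed

text \<open>A single eigenvalue that is at most \<open>- r\<close>, where \<open>r\<close> is the
  Randic index, already contributes enough to \<open>s_minus\<close>.\<close>

lemma randic_index_sq_le_s_minus_if_complete_bipartite: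
  assumes "complete_bipartite_digraph p q G" and ne: "arcs_ends G \<noteq> {}"
  shows "(randic_index G)\<^sup>2 \<le> s_minus G"
proof -
  obtain U W where V: "verts G = U \<union> W" "U \<inter> W = {}" and card: "card U = p" "card W = q"
    and E: "arcs_ends G = U \<times> W \<union> W \<times> U"
    using assms(1) by (auto simp: complete_bipartite_digraph_def)
  obtain n lam u where sf: "spectral_form (verts G) n (adj G) lam u"
    and s: "s_minus G = (\<Sum>k\<in>{k. k < n \<and> lam k < 0}. (lam k)\<^sup>2)"
    by (rule adjacency_spectrum)
  interpret spectral_form "verts G" n "adj G" lam u
    by (fact sf)
  have fin: "finite U" "finite W"
    using finite_verts unfolding V(1) by simp_all
  have degU: "out_degree G v = q" if "v \<in> U" for v
  proof -
    have "{w \<in> verts G. (v, w) \<in> arcs_ends G} = W"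
      using that V by (auto simp: E)
    then show ?thesis
      by (simp add: out_degree_eq_card card)
  qed
  have degW: "out_degree G v = p" if "v \<in> W" for v
  proof -
    have "{w \<in> verts G. (v, w) \<in> arcs_ends G} = U"
      using that V by (auto simp: E)
    then show ?thesis
      by (simp add: out_degree_eq_card card)
  qed
  define N where "N = real (card (arcs_ends G))"
  have N: "0 < N"
    using ne finite_arcs_ends by (auto simp: N_def card_gt_0_iff)
  \<comment> \<open>There are \<open>p * q\<close> edges, each of weight \<open>1 / r\<close>, so
    the Randic index is \<open>r\<close> itself.\<close>
  define r where "r = sqrt (real p * real q)"
  have card_N: "N = 2 * (real p * real q)"
    unfolding N_def E using V fin card by (subst card_Un_disjoint) (auto simp: card_cartesian_product)
  then have r: "r\<^sup>2 = real p * real q" "0 < r"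
    using N by (auto simp: r_def)
  have edge: "real (out_degree G v) * real (out_degree G w) = real p * real q" if "(v, w) \<in> arcs_ends G" for v w
    using that by (auto simp: E degU degW)
  have "2 * randic_index G = (\<Sum>(v, w)\<in>arcs_ends G. 1 / r)"
    unfolding randic_index_arcs by (rule sum.cong[OF refl]) (use edge in \<open>auto simp: r_def\<close>)
  also have "\<dots> = N / r"
    by (simp add: N_def case_prod_unfold)
  also have "\<dots> = 2 * r"
    using r(2) unfolding card_N r(1)[symmetric] by (simp add: power2_eq_square)
  finally have R: "randic_index G = r"
    by simp
  \<comment> \<open>The sign changes across every edge, so each arc contributes \<open>- r\<close>
    to the quadratic form; its Rayleigh quotient is therefore \<open>- r\<close>.\<close>
  define x where "x v = (if v \<in> U then 1 else - 1) * sqrt (real (out_degree G v))" for v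
  have "(x v)\<^sup>2 = real (out_degree G v)" for v
    by (simp add: x_def power_mult_distrib)
  then have norm: "(\<Sum>v\<in>verts G. (x v)\<^sup>2) = N"
    using sum_out_degree by (simp add: N_def)
  have "x v * x w = - r" if vw: "(v, w) \<in> arcs_ends G" for v w
  proof -
    have "x v * x w = - sqrt (real (out_degree G v) * real (out_degree G w))"
      using vw V(2) by (auto simp: x_def E real_sqrt_mult)
    then show ?thesis
      by (simp add: edge[OF vw] r_def)
  qed
  then have "(\<Sum>(v, w)\<in>arcs_ends G. x v * x w) = (\<Sum>(v, w)\<in>arcs_ends G. - r)"
    by (intro sum.cong) auto
  moreover have "(\<Sum>v\<in>verts G. \<Sum>w\<in>verts G. adj G v w * x v * x w) = (\<Sum>(v, w)\<in>arcs_ends G. x v * x w)"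
    using sum_adj[of "\<lambda>v w. x v * x w"] by (simp add: mult.assoc)
  ultimately have "(\<Sum>v\<in>verts G. \<Sum>w\<in>verts G. adj G v w * x v * x w) = - r * (\<Sum>v\<in>verts G. (x v)\<^sup>2)"
    unfolding norm by (simp add: N_def case_prod_unfold)
  then obtain k where k: "k < n" "lam k \<le> - r"
    using ex_eigenvalue_le[of x "- r"] norm N by (metis order_refl)
  then have "r\<^sup>2 \<le> (lam k)\<^sup>2"
    using power_mono[of r "- lam k" 2] r(2) by simp
  also have "\<dots> \<le> s_minus G"
    unfolding s using k r(2) by (intro member_le_sum) auto
  finally show ?thesis
    by (simp add: R)
qed

section \<open>Connectedness and the final case analysis\<close>

lemma connected_isolated_vertex:
  assumes "Digraph_Component.connected G" "v \<in> verts G" "\<nexists>w. (v, w) \<in> arcs_ends G"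
  shows "verts G = {v}"
proof -
  \<comment> \<open>Arcs are symmetric, so connectedness yields directed walks; a walk from
    \<open>v\<close> to another vertex would have to start with an arc leaving
    \<open>v\<close>.\<close>
  have sc: "strongly_connected G"
    using symmetric_connected_imp_strongly_connected[OF sym_arcs assms(1)] .
  have "w = v" if "w \<in> verts G" for w
  proof -
    have "v \<rightarrow>\<^sup>*\<^bsub>G\<^esub> w"
      using sc that assms(2) by (simp add: strongly_connected_def)
    then show ?thesis
      using assms(3) by (cases rule: converse_reachable_cases) auto
  qed
  then show ?thesis
    using assms(2) by blast
qed

end

theorem theorem6:
  fixes G :: "('a, 'b) pre_digraph"
  assumes "graph G"
    and "Digraph_Component.connected G"
  shows "sqrt (s_minus G) \<le> randic_index G \<and>
    (sqrt (s_minus G) = randic_index G \<longleftrightarrow> (\<exists>m n. complete_bipartite_digraph m n G))"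
proof -
  interpret graph G
    by fact
  show ?thesis
  proof (cases "arcs_ends G = {}")
    case True
    have "verts G \<noteq> {}"
      using assms(2) by (simp add: connected_conv)
    then obtain v where "v \<in> verts G"
      by blast
    then have V: "verts G = {v}"
      using connected_isolated_vertex[OF assms(2)] True by simp
    \<comment> \<open>One side of a complete bipartite graph may be empty, so the single vertex
      belongs to the equality case, with both quantities 0.\<close>
    have "complete_bipartite_digraph 1 0 G"
      unfolding complete_bipartite_digraph_def
      by (rule conjI[OF assms(1)], rule exI[of _ "{v}"], rule exI[of _ "{}"]) (simp add: True V)
    then show ?thesis
      using edgeless[OF True] by auto
  next
    case False
    \<comment> \<open>An isolated vertex would be the only vertex, and any arc would then be a
      loop.\<close>
    have nbr: "\<exists>w. (v, w) \<in> arcs_ends G" if "v \<in> verts G" for v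
    proof (rule ccontr)
      assume isolated: "\<not> ?thesis"
      then have V: "verts G = {v}"
        by (rule connected_isolated_vertex[OF assms(2) that])
      obtain x y where "(x, y) \<in> arcs_ends G"
        using False by fastforce
      then have "(v, v) \<in> arcs_ends G"
        using adj_in_verts[of x y] by (simp add: V)
      then show False
        by (rule adj_not_same)
    qed
    have le: "sqrt (s_minus G) \<le> randic_index G"
      using s_minus_le_randic_index_sq[OF False] randic_index_nonneg by (rule real_le_lsqrt[rotated -1])
    have "\<exists>m n. complete_bipartite_digraph m n G" if eq: "sqrt (s_minus G) = randic_index G"
    proof -
      \<comment> \<open>A positive root forces \<open>s_minus G\<close> to be positive, so that
        squaring undoes the root.\<close>
      have "0 < sqrt (s_minus G)"
        using eq randic_index_pos[OF False] by simp
      then have "s_minus G = (sqrt (s_minus G))\<^sup>2"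
        by simp
      then have "s_minus G = (randic_index G)\<^sup>2"
        by (simp only: eq)
      then obtain f g c where "0 < c"
        and adj: "\<forall>v\<in>verts G. \<forall>w\<in>verts G. adj G v w = c * (f v * f w - g v * g w)"
        using s_minus_eq_randic_index_sqD[OF False] by blast
      then have "c \<noteq> 0"
        by simp
      then show ?thesis
        by (rule complete_bipartite_if_rank_two[of c f g]) (use adj nbr in blast)+
    qed
    moreover have "randic_index G \<le> sqrt (s_minus G)" if "complete_bipartite_digraph m n G" for m n
      using randic_index_sq_le_s_minus_if_complete_bipartite[OF that False] by (rule real_le_rsqrt)
    ultimately show ?thesis
      using le order_antisym by blast
  qed
qed

end
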